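(* Let $G$ be a balanced bipartite graph on $2n$ vertices. If $q(\widehat{G})\le n$, then $G$ is traceable unless $G\in\{R_n^k: 1\le k\le\lfloor n/2\rfloor\}$.
   Context: Graphs are finite and simple. A bipartite graph comes with a fixed bipartition $\{X,Y\}$; it is balanced if $|X|=|Y|$. A graph is traceable if it contains a spanning path (Hamilton path). $q(G)$ is the signless Laplacian spectral radius, i.e. the largest eigenvalue of $D(G)+A(G)$, where $A(G)$ is the adjacency matrix and $D(G)$ the diagonal degree matrix. The quasi-complement $\widehat{G}$ of a bipartite graph $G$ with bipartition $\{X,Y\}$ is the bipartite graph with the same vertex set and bipartition such that, for $x\in X$ and $y\in Y$, $xy\in E(\widehat G)$ if and only if $xy\notin E(G)$. Equality of graphs is up to isomorphism (respecting bipartitions, possibly interchanging the two parts). $K_{m,n}$ is the complete bipartite graph with parts of sizes $|X|=m$, $|Y|=n$. Define $R_n^k=K_{k,k}\cup K_{n-k,n-k}$ (disjoint union, with each part of the bipartition consisting of one part of each component, so the bipartition is balanced with parts of size $n$) for $1\le k\le n/2$. *)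

theory Defs
  imports "Graph_Theory.Graph_Theory" "Jordan_Normal_Form.Spectral_Radius"
begin

text \<open>
  A finite simple graph is a \<open>pair_graph\<close>: a finite, loop-free, symmetric digraph without
  parallel arcs, so that an edge \<open>uv\<close> is represented by the two arcs \<open>(u, v)\<close> and \<open>(v, u)\<close>.
\<close>

locale bipartite_graph = pair_graph G for G :: "'a pair_pre_digraph" +
  fixes X Y :: "'a set"
  assumes verts_parts: "pverts G = X \<union> Y"
    and parts_disjoint: "X \<inter> Y = {}"
    and edges_between: "parcs G \<subseteq> X \<times> Y \<union> Y \<times> X"

locale balanced_bipartite_graph = bipartite_graph +
  assumes balanced: "card X = card Y"

definition quasi_complement :: "'a set \<Rightarrow> 'a set \<Rightarrow> 'a pair_pre_digraph \<Rightarrow> 'a pair_pre_digraph" where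
  "quasi_complement X Y G =
     \<lparr> pverts = pverts G, parcs = (X \<times> Y \<union> Y \<times> X) - parcs G \<rparr>"

definition traceable :: "'a pair_pre_digraph \<Rightarrow> bool" where
  "traceable G \<longleftrightarrow> (\<exists>p. vpath p (with_proj G) \<and> set p = pverts G)"

text \<open>
  The matrices are taken with respect to a list \<open>vs\<close> enumerating the vertices. In a
  \<open>pair_graph\<close> the out-degree of a vertex is its degree.
\<close>

definition adjacency_mat :: "'a list \<Rightarrow> 'a pair_pre_digraph \<Rightarrow> real mat" where
  "adjacency_mat vs G = mat (length vs) (length vs)
     (\<lambda>(i, j). if (vs ! i, vs ! j) \<in> parcs G then 1 else 0)"

definition degree_mat :: "'a list \<Rightarrow> 'a pair_pre_digraph \<Rightarrow> real mat" where
  "degree_mat vs G = mat (length vs) (length vs)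
     (\<lambda>(i, j). if i = j then real (out_degree (with_proj G) (vs ! i)) else 0)"

definition signless_laplacian :: "'a list \<Rightarrow> 'a pair_pre_digraph \<Rightarrow> real mat" where
  "signless_laplacian vs G = degree_mat vs G + adjacency_mat vs G"

definition vertex_enum :: "'a pair_pre_digraph \<Rightarrow> 'a list" where
  "vertex_enum G = (SOME vs. distinct vs \<and> set vs = pverts G)"

text \<open>
  The signless Laplacian is real symmetric, so the maximum over its real eigenvalues is its
  largest eigenvalue. It is meaningful only if the graph has a vertex. By
  \<open>spectrum_signless_laplacian_enum\<close> below, the choice of the enumeration is irrelevant.
\<close>

definition signless_radius :: "'a pair_pre_digraph \<Rightarrow> real" where
  "signless_radius G = Max (spectrum (signless_laplacian (vertex_enum G) G))"

text \<open>
  Equality of bipartite graphs: an isomorphism carries the unordered bipartition of the first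
  graph to that of the second, so the two parts may be interchanged.
\<close>

definition bipartite_iso ::
  "'a pair_pre_digraph \<Rightarrow> 'a set \<Rightarrow> 'a set \<Rightarrow> 'b pair_pre_digraph \<Rightarrow> 'b set \<Rightarrow> 'b set \<Rightarrow> bool" where
  "bipartite_iso G X Y H X' Y' \<longleftrightarrow>
     (\<exists>\<phi>. bij_betw \<phi> (pverts G) (pverts H) \<and>
          (\<forall>u \<in> pverts G. \<forall>v \<in> pverts G. (u, v) \<in> parcs G \<longleftrightarrow> (\<phi> u, \<phi> v) \<in> parcs H) \<and>
          {\<phi> ` X, \<phi> ` Y} = {X', Y'})"

definition complete_bipartite :: "'a set \<Rightarrow> 'a set \<Rightarrow> 'a pair_pre_digraph" where
  "complete_bipartite A B = \<lparr> pverts = A \<union> B, parcs = A \<times> B \<union> B \<times> A \<rparr>"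

definition pair_union :: "'a pair_pre_digraph \<Rightarrow> 'a pair_pre_digraph \<Rightarrow> 'a pair_pre_digraph" where
  "pair_union G H = \<lparr> pverts = pverts G \<union> pverts H, parcs = parcs G \<union> parcs H \<rparr>"

text \<open>
  \<open>R_graph n k\<close> has parts \<open>left_part n\<close> and \<open>right_part n\<close>; its component \<open>K\<^bsub>k,k\<^esub>\<close> lives on the
  first \<open>k\<close> vertices of each part, and \<open>K\<^bsub>n-k,n-k\<^esub>\<close> on the others.
\<close>

definition left_part :: "nat \<Rightarrow> (nat + nat) set" where
  "left_part n = Inl ` {..<n}"

definition right_part :: "nat \<Rightarrow> (nat + nat) set" where
  "right_part n = Inr ` {..<n}"

definition R_graph :: "nat \<Rightarrow> nat \<Rightarrow> (nat + nat) pair_pre_digraph" where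
  "R_graph n k = pair_union
     (complete_bipartite (Inl ` {..<k}) (Inr ` {..<k}))
     (complete_bipartite (Inl ` {k..<n}) (Inr ` {k..<n}))"

lemma bipartite_graph_quasi_complement:
  assumes "bipartite_graph G X Y"
  shows "bipartite_graph (quasi_complement X Y G) X Y"
proof -
  interpret bipartite_graph G X Y by fact
  have fin: "finite X" "finite Y"
    using pair_finite_verts verts_parts by auto
  have sym: "(u, v) \<in> parcs G \<longleftrightarrow> (v, u) \<in> parcs G" for u v
    using pair_sym_arcs by (auto simp: symmetric_def dest: symD)
  show ?thesis
    by unfold_locales
      (use fin sym verts_parts parts_disjoint in
        \<open>auto simp: quasi_complement_def symmetric_def intro!: symI\<close>)
qed

lemma balanced_bipartite_graph_R_graph:
  assumes "k \<le> n"
  shows "balanced_bipartite_graph (R_graph n k) (left_part n) (right_part n)"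
  by unfold_locales
    (use assms in \<open>auto simp: R_graph_def pair_union_def complete_bipartite_def left_part_def
      right_part_def symmetric_def card_image image_iff intro!: symI\<close>)

lemma complete_bipartite_is_K:
  assumes "finite A" "finite B" "A \<inter> B = {}"
  shows "K\<^bsub>card A,card B\<^esub> (with_proj (complete_bipartite A B))"
  unfolding complete_bipartite_digraph_pair_def
  using assms by (auto simp: complete_bipartite_def)

lemma eigenvalue_signless_laplacian_iff:
  assumes vs: "distinct vs" "set vs = pverts G"
  shows "eigenvalue (signless_laplacian vs G) k \<longleftrightarrow>
    (\<exists>f. (\<exists>v \<in> pverts G. f v \<noteq> 0) \<and>
      (\<forall>v \<in> pverts G. real (out_degree (with_proj G) v) * f v
         + (\<Sum>w | w \<in> pverts G \<and> (v, w) \<in> parcs G. f w) = k * f v))"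
proof -
  let ?m = "length vs" and ?Q = "signless_laplacian vs G"
  let ?d = "\<lambda>v. real (out_degree (with_proj G) v)"
  have sum_vs: "(\<Sum>j<?m. h (vs ! j)) = (\<Sum>w\<in>pverts G. h w)" for h :: "'a \<Rightarrow> real"
    by (rule sum.reindex_bij_betw) (use bij_betw_nth[OF vs(1) refl, of "pverts G"] vs in simp)
  have ball_vs: "(\<forall>v \<in> pverts G. P v) \<longleftrightarrow> (\<forall>i<?m. P (vs ! i))" for P
    using vs(2) by (metis in_set_conv_nth)
  have fin: "finite (pverts G)"
    using vs(2) by (metis List.finite_set)
  have mult: "(?Q *\<^sub>v vec ?m (\<lambda>i. f (vs ! i))) $ i
      = ?d (vs ! i) * f (vs ! i) + (\<Sum>w | w \<in> pverts G \<and> (vs ! i, w) \<in> parcs G. f w)"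
    if i: "i < ?m" for f i
  proof -
    have "(?Q *\<^sub>v vec ?m (\<lambda>i. f (vs ! i))) $ i
        = (\<Sum>j<?m. ((if i = j then ?d (vs ! i) else 0)
            + (if (vs ! i, vs ! j) \<in> parcs G then 1 else 0)) * f (vs ! j))"
      using i by (simp add: signless_laplacian_def degree_mat_def adjacency_mat_def
          scalar_prod_def atLeast0LessThan)
    also have "\<dots> = (\<Sum>j<?m. if i = j then ?d (vs ! i) * f (vs ! j) else 0)
        + (\<Sum>j<?m. if (vs ! i, vs ! j) \<in> parcs G then f (vs ! j) else 0)"
      unfolding sum.distrib[symmetric] by (rule sum.cong) (auto simp: algebra_simps)
    also have "(\<Sum>j<?m. if i = j then ?d (vs ! i) * f (vs ! j) else 0) = ?d (vs ! i) * f (vs ! i)"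
      using i by simp
    also have "(\<Sum>j<?m. if (vs ! i, vs ! j) \<in> parcs G then f (vs ! j) else 0)
        = (\<Sum>w\<in>pverts G. if (vs ! i, w) \<in> parcs G then f w else 0)"
      by (rule sum_vs)
    also have "\<dots> = (\<Sum>w | w \<in> pverts G \<and> (vs ! i, w) \<in> parcs G. f w)"
      using sum.inter_filter[OF fin, of f "\<lambda>w. (vs ! i, w) \<in> parcs G"] by simp
    finally show ?thesis .
  qed
  have dim: "dim_row ?Q = ?m"
    by (simp add: signless_laplacian_def adjacency_mat_def)
  have ev: "eigenvector ?Q (vec ?m (\<lambda>i. f (vs ! i))) k \<longleftrightarrow>
    (\<exists>v \<in> pverts G. f v \<noteq> 0) \<and>
      (\<forall>v \<in> pverts G. ?d v * f v
         + (\<Sum>w | w \<in> pverts G \<and> (v, w) \<in> parcs G. f w) = k * f v)" for f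
  proof -
    have "vec ?m (\<lambda>i. f (vs ! i)) \<noteq> 0\<^sub>v ?m \<longleftrightarrow> (\<exists>v \<in> pverts G. f v \<noteq> 0)"
      unfolding vs(2)[symmetric] by (simp add: vec_eq_iff) (metis in_set_conv_nth)
    moreover have "?Q *\<^sub>v vec ?m (\<lambda>i. f (vs ! i)) = k \<cdot>\<^sub>v vec ?m (\<lambda>i. f (vs ! i)) \<longleftrightarrow>
      (\<forall>i<?m. (?Q *\<^sub>v vec ?m (\<lambda>i. f (vs ! i))) $ i = k * f (vs ! i))"
      by (auto simp: vec_eq_iff dim simp del: index_mult_mat_vec)
    moreover have "\<dots> \<longleftrightarrow> (\<forall>v \<in> pverts G. ?d v * f v
         + (\<Sum>w | w \<in> pverts G \<and> (v, w) \<in> parcs G. f w) = k * f v)"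
      by (simp add: mult ball_vs del: index_mult_mat_vec)
    ultimately show ?thesis
      by (simp add: eigenvector_def dim)
  qed
  have "\<exists>f. v = vec ?m (\<lambda>i. f (vs ! i))" if v: "eigenvector ?Q v k" for v
  proof
    have "v \<in> carrier_vec ?m"
      using v by (simp add: eigenvector_def dim)
    then show "v = vec ?m (\<lambda>i. (\<lambda>w. v $ the_inv_into {..<?m} ((!) vs) w) (vs ! i))"
      using vs(1) by (auto simp: the_inv_into_f_f inj_on_nth)
  qed
  then show ?thesis
    unfolding eigenvalue_def ev[symmetric] by metis
qed

lemma spectrum_signless_laplacian_enum:
  assumes "distinct vs" "set vs = pverts G" "distinct ws" "set ws = pverts G"
  shows "spectrum (signless_laplacian vs G) = spectrum (signless_laplacian ws G)"
proof (rule Set.set_eqI)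
  fix k
  show "k \<in> spectrum (signless_laplacian vs G) \<longleftrightarrow> k \<in> spectrum (signless_laplacian ws G)"
    unfolding spectrum_def mem_Collect_eq eigenvalue_signless_laplacian_iff[OF assms(1,2)]
      eigenvalue_signless_laplacian_iff[OF assms(3,4)] ..
qed

end

theory Submission
  imports Defs "HOL-Analysis.Function_Topology"
begin

text \<open>
  Let \<open>R\<close> be an edge-maximal non-traceable bipartite graph containing \<open>G\<close>. Adding a missing edge
  \<open>uv\<close> to \<open>R\<close> creates a Hamilton path, and Ore's crossing argument gives \<open>d(u) + d(v) \<le> n\<close>, that is
  \<open>d'(u) + d'(v) \<ge> n\<close> for the degrees \<open>d'\<close> in the quasi-complement of \<open>R\<close>. The vector \<open>d'\<close> then has
  Rayleigh quotient at least \<open>n\<close> in the signless Laplacian of the quasi-complement of \<open>G\<close>. As the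
  largest eigenvalue is at most \<open>n\<close>, all these inequalities are equalities, and \<open>d'\<close> vanishes at
  the ends of every edge of \<open>R\<close> outside \<open>G\<close>.

  Hence \<open>d(u) + d(v) = n\<close> for all missing edges of \<open>R\<close>. Removing \<open>uv\<close> from the Hamilton path leaves
  two paths. If the vertices of one of them spanned no cycle, a crossing argument would bound the
  degree sum of its ends by \<open>n - 1\<close>; so there are two disjoint cycles that together are spanning.
  No edge joins them, because it would give a Hamilton path, and the degree sums now force \<open>R\<close> to be a
  disjoint union of two balanced complete bipartite graphs. Then \<open>d'\<close> is positive everywhere, so
  \<open>R = G\<close>.
\<close>

section \<open>The Rayleigh quotient of the signless Laplacian\<close>

text \<open>By Tychonoff: vanishing outside \<open>V\<close> makes the set a product of compact
  factors over the whole index type. This is the compactness behind maximising a quadratic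
  form.\<close>

lemma compact_supported_box:
  fixes V :: "'a set"
  shows "compact {f :: 'a \<Rightarrow> real. (\<forall>v \<in> V. f v \<in> {-1..1}) \<and> (\<forall>v. v \<notin> V \<longrightarrow> f v = 0)}"
proof -
  let ?S = "\<lambda>v. if v \<in> V then {-1..1} else {0 :: real}"
  have "compactin (product_topology (\<lambda>v :: 'a. euclidean) UNIV) (PiE UNIV ?S)"
    unfolding compactin_PiE by auto
  then have "compact (PiE UNIV ?S)"
    by (simp add: euclidean_product_topology)
  also have "PiE UNIV ?S = {f. (\<forall>v \<in> V. f v \<in> {-1..1}) \<and> (\<forall>v. v \<notin> V \<longrightarrow> f v = 0)}"
    by (auto simp: PiE_iff split: if_splits) 
  finally show ?thesis .
qed

text \<open>For small \<open>t\<close> the linear term dominates; this is the first-order condition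
  at a maximum.\<close>

lemma zero_if_quadratic_nonpos:
  fixes c e :: real
  assumes "\<And>t. 2 * t * c + t\<^sup>2 * e \<le> 0"
  shows "c = 0"
proof (rule ccontr)
  assume c: "c \<noteq> 0"
  \<comment> \<open>At \<open>t = c / m\<close> the linear term is \<open>2 * c\<^sup>2 / m\<close>,
    and \<open>- m \<le> e\<close> keeps the quadratic term at least
    \<open>- c\<^sup>2 / m\<close>.\<close>
  define m where "m = \<bar>e\<bar> + 1"
  have m: "m > 0" "- m \<le> e" unfolding m_def by linarith+
  have "0 < (c / m)\<^sup>2 * m"
    using c m by simp
  also have "\<dots> = 2 * (c / m) * c + (c / m)\<^sup>2 * (- m)"
    using m by (simp add: field_simps power2_eq_square)
  also have "\<dots> \<le> 2 * (c / m) * c + (c / m)\<^sup>2 * e"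
    using m by (intro add_left_mono mult_left_mono) auto
  also have "\<dots> \<le> 0" by (rule assms)
  finally show False by simp
qed

text \<open>The variational characterisation of the largest eigenvalue: the form attains its maximum
  on the unit sphere, homogeneity extends the bound to all \<open>g\<close>, and the first variation
  at the maximiser is the eigenvalue equation.\<close>

lemma symmetric_kernel_max_eigenfunction:
  fixes a :: "'a \<Rightarrow> 'a \<Rightarrow> real"
  assumes fin: "finite V" and ne: "V \<noteq> {}" and sym: "\<And>v w. a v w = a w v"
  obtains f k where "\<exists>v \<in> V. f v \<noteq> 0"
    and "\<And>v. v \<in> V \<Longrightarrow> (\<Sum>w\<in>V. a v w * f w) = k * f v"
    and "\<And>g. (\<Sum>v\<in>V. \<Sum>w\<in>V. a v w * g v * g w) \<le> k * (\<Sum>v\<in>V. (g v)\<^sup>2)"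
proof -
  define q where "q g = (\<Sum>v\<in>V. \<Sum>w\<in>V. a v w * g v * g w)" for g
  define s where "s g = (\<Sum>v\<in>V. (g v)\<^sup>2)" for g :: "'a \<Rightarrow> real"
  \<comment> \<open>The unit sphere of functions supported on \<open>V\<close>, written as a closed
    subset of a compact box.\<close>
  define K where "K = {f. (\<forall>v \<in> V. f v \<in> {-1..1}) \<and> (\<forall>v. v \<notin> V \<longrightarrow> f v = 0)} \<inter> {f. s f = 1}"
  have cont_coord [continuous_intros]: "continuous_on A (\<lambda>f :: 'a \<Rightarrow> real. f v)" for A v
    using continuous_on_product_coordinates by (rule continuous_on_subset) simp
  have "closed {f. s f = 1}"
    unfolding s_def by (intro closed_Collect_eq continuous_intros)
  then have "compact K"
    unfolding K_def by (intro compact_Int_closed compact_supported_box)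
  moreover have normalized: "(\<lambda>v. if v \<in> V then g v / sqrt (s g) else 0) \<in> K" (is "?h \<in> K")
    if pos: "s g > 0" for g
  proof -
    have abs_le: "\<bar>g v\<bar> \<le> sqrt (s g)" if "v \<in> V" for v
      using member_le_sum[of v V "\<lambda>v. (g v)\<^sup>2"] that fin unfolding s_def
      by (intro real_le_rsqrt) auto
    have "- 1 \<le> g v / sqrt (s g)" "g v / sqrt (s g) \<le> 1" if "v \<in> V" for v
      using abs_le[OF that] pos by (simp_all add: abs_le_iff pos_le_divide_eq pos_divide_le_eq)
    moreover have "s ?h = (\<Sum>v\<in>V. (g v)\<^sup>2 / s g)"
      using pos unfolding s_def[of ?h] by (intro sum.cong) (auto simp: power_divide)
    then have "s ?h = 1"
      using pos by (simp add: sum_divide_distrib[symmetric] s_def)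
    ultimately show ?thesis
      by (simp add: K_def)
  qed
  moreover have "K \<noteq> {}"
  proof -
    have "s (\<lambda>_. 1) > 0" using fin ne by (simp add: s_def card_gt_0_iff)
    from normalized[OF this] show ?thesis by blast
  qed
  moreover have "continuous_on K q"
    unfolding q_def by (intro continuous_intros)
  ultimately obtain f where f: "f \<in> K" and max: "\<And>g. g \<in> K \<Longrightarrow> q g \<le> q f"
    using continuous_attains_sup by metis
  have sf: "s f = 1" using f by (simp add: K_def)
  have bound: "q g \<le> q f * s g" for g
  proof (cases "s g = 0")
    case True
    then have "\<forall>v \<in> V. g v = 0"
      using fin by (simp add: s_def sum_nonneg_eq_0_iff)
    then show ?thesis using True by (simp add: q_def)
  next
    case False
    then have pos: "s g > 0" by (simp add: s_def less_le sum_nonneg)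
    let ?h = "\<lambda>v. if v \<in> V then g v / sqrt (s g) else 0"
    have "q ?h = (\<Sum>v\<in>V. \<Sum>w\<in>V. a v w * g v * g w / s g)"
      using pos unfolding q_def by (intro sum.cong) auto
    also have "\<dots> = q g / s g"
      unfolding q_def by (simp add: sum_divide_distrib)
    finally show ?thesis
      using max[OF normalized[OF pos]] pos by (simp add: pos_divide_le_eq)
  qed
  have eig: "(\<Sum>w\<in>V. a z w * f w) = q f * f z" if z: "z \<in> V" for z
  proof -
    let ?e = "\<lambda>v. if v = z then 1 else 0 :: real"
    \<comment> \<open>The maximiser is perturbed in the single coordinate \<open>z\<close>; symmetry
      of \<open>a\<close> merges the two mixed sums into the factor 2.\<close>
    have q_pert: "q (\<lambda>v. f v + t * ?e v) = q f + 2 * t * (\<Sum>w\<in>V. a z w * f w) + t\<^sup>2 * a z z" for t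
    proof -
      have "q (\<lambda>v. f v + t * ?e v)
          = (\<Sum>v\<in>V. \<Sum>w\<in>V. a v w * f v * f w
              + (t * ((a v w * f w) * ?e v) + (t * ((a v w * f v) * ?e w) + t\<^sup>2 * ((a v w * ?e v) * ?e w))))"
        unfolding q_def by (intro sum.cong refl) (simp add: algebra_simps power2_eq_square)
      also have "\<dots> = q f + (t * (\<Sum>v\<in>V. (\<Sum>w\<in>V. a v w * f w) * ?e v)
          + (t * (\<Sum>v\<in>V. \<Sum>w\<in>V. (a v w * f v) * ?e w)
          + t\<^sup>2 * (\<Sum>v\<in>V. \<Sum>w\<in>V. (a v w * ?e v) * ?e w)))"
        unfolding sum.distrib sum_distrib_left sum_distrib_right q_def by (rule refl)
      also have "(\<Sum>v\<in>V. \<Sum>w\<in>V. (a v w * f v) * ?e w) = (\<Sum>v\<in>V. a v z * f v)"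
        using z fin by (intro sum.cong refl) (simp add: if_distrib cong: if_cong)
      also have "(\<Sum>v\<in>V. a v z * f v) = (\<Sum>w\<in>V. a z w * f w)"
        by (simp add: sym)
      also have "(\<Sum>v\<in>V. \<Sum>w\<in>V. (a v w * ?e v) * ?e w) = (\<Sum>v\<in>V. a v z * ?e v)"
        using z fin by (intro sum.cong refl) (simp add: if_distrib cong: if_cong)
      also have "\<dots> = a z z"
        using z fin by (simp add: if_distrib cong: if_cong)
      also have "(\<Sum>v\<in>V. (\<Sum>w\<in>V. a v w * f w) * ?e v) = (\<Sum>w\<in>V. a z w * f w)"
        using z fin by (simp add: if_distrib cong: if_cong)
      finally show ?thesis by simp
    qed
    have s_pert: "s (\<lambda>v. f v + t * ?e v) = 1 + 2 * t * f z + t\<^sup>2" for t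
    proof -
      have "s (\<lambda>v. f v + t * ?e v) = (\<Sum>v\<in>V. (f v)\<^sup>2 + (2 * t * (f v * ?e v) + t\<^sup>2 * ?e v))"
        unfolding s_def by (intro sum.cong refl) (simp add: algebra_simps power2_eq_square)
      also have "\<dots> = s f + (2 * t * (\<Sum>v\<in>V. f v * ?e v) + t\<^sup>2 * (\<Sum>v\<in>V. ?e v))"
        unfolding sum.distrib sum_distrib_left s_def by (rule refl)
      also have "\<dots> = 1 + 2 * t * f z + t\<^sup>2"
        using z fin sf by (simp add: if_distrib cong: if_cong)
      finally show ?thesis .
    qed
    \<comment> \<open>As \<open>s f = 1\<close>, the constant terms of the bound cancel, and a
      quadratic in \<open>t\<close> that is never positive remains.\<close>
    have "2 * t * ((\<Sum>w\<in>V. a z w * f w) - q f * f z) + t\<^sup>2 * (a z z - q f) \<le> 0" for t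
      using bound[of "\<lambda>v. f v + t * ?e v"] unfolding q_pert s_pert
      by (simp add: algebra_simps)
    from zero_if_quadratic_nonpos[OF this] show ?thesis by simp
  qed
  have "\<exists>v \<in> V. f v \<noteq> 0"
  proof (rule ccontr)
    assume "\<not> ?thesis"
    then have "s f = 0" by (simp add: s_def)
    with sf show False by simp
  qed
  with eig bound show thesis
    using that[of f "q f"] unfolding q_def s_def by blast
qed

text \<open>The left side is the quadratic form of the signless Laplacian: the two arcs of an edge
  \<open>vw\<close> together contribute \<open>(g v + g w)\<^sup>2\<close>. The largest eigenvalue
  bounds the form and belongs to the spectrum over which \<open>signless_radius\<close> takes the
  maximum.\<close>

lemma signless_radius_bounds_quadratic_form:
  fixes H :: "'a pair_pre_digraph"
  assumes "pair_graph H" and ne: "pverts H \<noteq> {}"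
  shows "(\<Sum>(v, w)\<in>parcs H. (g v + g w) * g v) \<le> signless_radius H * (\<Sum>v\<in>pverts H. (g v)\<^sup>2)"
proof -
  interpret pair_graph H by fact
  let ?V = "pverts H" and ?R = "parcs H"
  let ?d = "\<lambda>v. real (out_degree (with_proj H) v)"
  \<comment> \<open>The entries of the signless Laplacian, indexed by vertices so that no
    enumeration enters the variational argument.\<close>
  define a where "a v w = (if v = w then ?d v else 0) + (if (v, w) \<in> ?R then 1 else 0)" for v w
  have fin: "finite ?V" "finite ?R" by (rule pair_finite_verts pair_finite_arcs)+
  have sub: "?R \<subseteq> ?V \<times> ?V" using in_arcsD1 in_arcsD2 by auto
  have symR: "(v, w) \<in> ?R \<longleftrightarrow> (w, v) \<in> ?R" for v w
    using pair_sym_arcs by (auto simp: symmetric_def dest: symD)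
  have a_sym: "a v w = a w v" for v w
    by (auto simp: a_def symR)
  have row: "(\<Sum>w\<in>?V. a v w * f w) = ?d v * f v + (\<Sum>w | w \<in> ?V \<and> (v, w) \<in> ?R. f w)"
    if v: "v \<in> ?V" for v f
  proof -
    have "(\<Sum>w\<in>?V. a v w * f w)
        = (\<Sum>w\<in>?V. if v = w then ?d v * f w else 0) + (\<Sum>w\<in>?V. if (v, w) \<in> ?R then f w else 0)"
      unfolding sum.distrib[symmetric] a_def by (rule sum.cong) (auto simp: algebra_simps)
    then show ?thesis using v fin by (simp add: sum.inter_filter[symmetric])
  qed
  obtain f k where f: "\<exists>v \<in> ?V. f v \<noteq> 0"
      "\<And>v. v \<in> ?V \<Longrightarrow> (\<Sum>w\<in>?V. a v w * f w) = k * f v"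
    and k: "\<And>g. (\<Sum>v\<in>?V. \<Sum>w\<in>?V. a v w * g v * g w) \<le> k * (\<Sum>v\<in>?V. (g v)\<^sup>2)"
    using symmetric_kernel_max_eigenfunction[where a = a, OF fin(1) ne a_sym] by blast
  have "\<exists>vs. distinct vs \<and> set vs = ?V"
    using finite_distinct_list[OF fin(1)] by blast
  from someI_ex[OF this] have enum: "distinct (vertex_enum H)" "set (vertex_enum H) = ?V"
    by (simp_all add: vertex_enum_def)
  let ?Q = "signless_laplacian (vertex_enum H) H"
  have "eigenvalue ?Q k"
    unfolding eigenvalue_signless_laplacian_iff[OF enum]
    by (intro exI[of _ f] conjI ballI) (use f(1) in blast, simp flip: row f(2))
  moreover have "?Q \<in> carrier_mat (length (vertex_enum H)) (length (vertex_enum H))"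
    by (simp add: signless_laplacian_def adjacency_mat_def)
  ultimately have "k \<le> signless_radius H"
    unfolding signless_radius_def
    by (intro Max_ge card_finite_spectrum(1)) (auto simp: spectrum_def)
  then have "k * (\<Sum>v\<in>?V. (g v)\<^sup>2) \<le> signless_radius H * (\<Sum>v\<in>?V. (g v)\<^sup>2)"
    by (intro mult_right_mono sum_nonneg) auto
  moreover have "(\<Sum>(v, w)\<in>?R. (g v + g w) * g v) = (\<Sum>v\<in>?V. \<Sum>w\<in>?V. a v w * g v * g w)"
  proof -
    have R_eq: "?R = (SIGMA v:?V. {w \<in> ?V. (v, w) \<in> ?R})" using sub by auto
    have "(\<Sum>(v, w)\<in>?R. (g v + g w) * g v)
        = (\<Sum>(v, w)\<in>(SIGMA v:?V. {w \<in> ?V. (v, w) \<in> ?R}). (g v + g w) * g v)"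
      by (rule sum.cong[OF R_eq refl])
    also have "\<dots> = (\<Sum>v\<in>?V. \<Sum>w | w \<in> ?V \<and> (v, w) \<in> ?R. (g v + g w) * g v)"
      by (rule sum.Sigma[symmetric]) (use fin in auto)
    also have "\<dots> = (\<Sum>v\<in>?V. \<Sum>w\<in>?V. a v w * g v * g w)"
    proof (rule sum.cong[OF refl])
      fix v assume v: "v \<in> ?V"
      have "out_arcs (with_proj H) v = Pair v ` {w \<in> ?V. (v, w) \<in> ?R}"
        using sub by (auto simp: with_proj_def out_arcs_def)
      then have "?d v = real (card {w \<in> ?V. (v, w) \<in> ?R})"
        by (simp add: out_degree_def card_image inj_on_def)
      then have "(\<Sum>w | w \<in> ?V \<and> (v, w) \<in> ?R. (g v + g w) * g v)
          = (?d v * g v + (\<Sum>w | w \<in> ?V \<and> (v, w) \<in> ?R. g w)) * g v"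
        by (simp add: sum_distrib_right[symmetric] sum.distrib)
      also have "\<dots> = (\<Sum>w\<in>?V. a v w * g w) * g v" using row[OF v] by simp
      also have "\<dots> = (\<Sum>w\<in>?V. a v w * g v * g w)"
        unfolding sum_distrib_right by (intro sum.cong) simp_all
      finally show "(\<Sum>w | w \<in> ?V \<and> (v, w) \<in> ?R. (g v + g w) * g v) = (\<Sum>w\<in>?V. a v w * g v * g w)" .
    qed
    finally show ?thesis .
  qed
  ultimately show ?thesis using k[of g] by linarith
qed

section \<open>Hamilton paths in balanced bipartite relations\<close>

text \<open>Stated for a bare relation, so that edges can be added and paths cut, reversed and glued
  as lists. The empty list counts as a path, unlike for \<open>vpath\<close>.\<close>

definition path_in :: "('a \<times> 'a) set \<Rightarrow> 'a list \<Rightarrow> bool" where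
  "path_in R p \<longleftrightarrow> distinct p \<and> successively (\<lambda>u v. (u, v) \<in> R) p"

lemma path_in_append:
  "path_in R (p @ q) \<longleftrightarrow> path_in R p \<and> path_in R q \<and> set p \<inter> set q = {}
     \<and> (p \<noteq> [] \<longrightarrow> q \<noteq> [] \<longrightarrow> (last p, hd q) \<in> R)"
  by (auto simp: path_in_def successively_append_iff)

lemma path_in_Cons:
  "path_in R (x # p) \<longleftrightarrow> path_in R p \<and> x \<notin> set p \<and> (p \<noteq> [] \<longrightarrow> (x, hd p) \<in> R)"
  by (auto simp: path_in_def successively_Cons)

lemma path_in_Nil: "path_in R []"
  by (simp add: path_in_def)

lemma path_in_rev: "sym R \<Longrightarrow> path_in R (rev p) \<longleftrightarrow> path_in R p"
  by (auto simp: path_in_def sym_def elim!: successively_mono)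

text \<open>The vertices of a path are distinct, so the new edge is traversed at most once, and
  cutting there leaves two paths in the old relation.\<close>

lemma split_at_new_edge:
  assumes "path_in (R \<union> {(u, v), (v, u)}) p" "\<not> path_in R p"
  shows "\<exists>A B. p = A @ B \<and> A \<noteq> [] \<and> B \<noteq> [] \<and> path_in R A \<and> path_in R B
    \<and> {last A, hd B} = {u, v} \<and> (last A, hd B) \<notin> R"
  using assms
proof (induction p)
  case Nil
  then show ?case by (simp add: path_in_Nil)
next
  case (Cons x p)
  have p: "path_in (R \<union> {(u, v), (v, u)}) p" "x \<notin> set p"
    using Cons.prems(1) by (auto simp: path_in_Cons)
  show ?case
  proof (cases "path_in R p")
    case True
    then have "p \<noteq> []" "(x, hd p) \<notin> R" "(x, hd p) \<in> R \<union> {(u, v), (v, u)}"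
      using Cons.prems p by (auto simp: path_in_Cons)
    with True show ?thesis
      by (intro exI[of _ "[x]"] exI[of _ p]) (auto simp: path_in_Cons path_in_Nil)
  next
    case False
    then obtain A B where AB: "p = A @ B" "A \<noteq> []" "B \<noteq> []" "path_in R A" "path_in R B"
      "{last A, hd B} = {u, v}" "(last A, hd B) \<notin> R"
      using Cons.IH p(1) by blast
    \<comment> \<open>Both \<open>u\<close> and \<open>v\<close> lie in \<open>p\<close>, which
      avoids \<open>x\<close>; so the step out of \<open>x\<close> is an old edge.\<close>
    have "last A \<in> set p" "hd B \<in> set p" using AB by auto
    then have "x \<noteq> u" "x \<noteq> v" using AB(6) p(2) by (auto simp: doubleton_eq_iff)
    then have "(x, hd A) \<in> R" using Cons.prems(1) AB by (auto simp: path_in_Cons)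
    then have "path_in R (x # A)" using AB p(2) by (simp add: path_in_Cons)
    with AB show ?thesis
      by (intro exI[of _ "x # A"] exI[of _ B]) simp
  qed
qed

text \<open>The successor along a list as a total function. Injectivity away from the last entry
  lets the crossing arguments count neighbours by counting their successors.\<close>

lemma distinct_list_successor:
  assumes "distinct p"
  obtains s where "\<And>C w z D. p = C @ w # z # D \<Longrightarrow> s w = z" and "inj_on s (set (butlast p))"
proof -
  \<comment> \<open>The range condition is added for the induction: it keeps the new value
    \<open>y\<close> apart from the values already taken.\<close>
  have "\<exists>s. (\<forall>C w z D. p = C @ w # z # D \<longrightarrow> s w = z) \<and> inj_on s (set (butlast p))
      \<and> s ` set (butlast p) \<subseteq> set (tl p)"
    using assms
  proof (induction p rule: induct_list012)
    case (3 x y p)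
    have "distinct (y # p)" using "3.prems" by simp
    from "3.IH"(2)[OF this] obtain s
      where s: "\<And>C w z D. y # p = C @ w # z # D \<Longrightarrow> s w = z"
        "inj_on s (set (butlast (y # p)))" "s ` set (butlast (y # p)) \<subseteq> set p"
      unfolding list.sel(3) by blast
    have x: "x \<notin> set (butlast (y # p))"
      using "3.prems" by (meson distinct.simps(2) in_set_butlastD)
    have "(s(x := y)) w = z" if eq: "x # y # p = C @ w # z # D" for C w z D
    proof (cases C)
      case Nil
      then show ?thesis using eq by simp
    next
      case (Cons c C')
      then have C': "y # p = C' @ w # z # D" using eq by simp
      then have "w \<in> set (y # p)" by simp
      then have "w \<noteq> x" using "3.prems" by auto
      then show ?thesis using s(1)[OF C'] by simp
    qed
    moreover have old: "(s(x := y)) ` set (butlast (y # p)) = s ` set (butlast (y # p))"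
      using x by (intro image_cong) auto
    have bl: "set (butlast (x # y # p)) = insert x (set (butlast (y # p)))" by simp
    have y: "y \<notin> s ` set (butlast (y # p))"
    proof -
      have "y \<notin> set p" using "3.prems" by simp
      then show ?thesis using s(3) by blast
    qed
    have "inj_on (s(x := y)) (set (butlast (x # y # p)))"
      unfolding bl inj_on_insert Diff_insert0[OF x] Diff_empty old
    proof
      show "inj_on (s(x := y)) (set (butlast (y # p)))"
        using s(2) x by (subst inj_on_cong[of _ _ s]) auto
      show "(s(x := y)) x \<notin> s ` set (butlast (y # p))"
        using y by simp
    qed
    moreover have "(s(x := y)) ` set (butlast (x # y # p)) \<subseteq> set (tl (x # y # p))"
    proof -
      have "s ` set (butlast (y # p)) \<subseteq> set (y # p)" using s(3) by (rule subset_trans) auto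
      then show ?thesis unfolding bl image_insert old by simp
    qed
    ultimately show ?case by blast
  qed auto
  then show thesis using that by blast
qed

lemma split_before:
  assumes "w \<in> set p" "w \<noteq> last p"
  obtains C z D where "p = C @ w # z # D"
proof -
  obtain C D where "p = C @ w # D" using assms(1) by (meson split_list)
  moreover from this have "D \<noteq> []" using assms(2) by auto
  ultimately show thesis using that by (cases D) auto
qed

lemma split_after:
  assumes "w \<in> set p" "w \<noteq> hd p"
  obtains C z D where "p = C @ z # w # D"
proof -
  obtain C D where "p = C @ w # D" using assms(1) by (meson split_list)
  moreover from this have "C \<noteq> []" using assms(2) by auto
  ultimately show thesis using that by (cases C rule: rev_cases) auto
qed

lemma in_set_butlast_if_not_last: "w \<in> set p \<Longrightarrow> w \<noteq> last p \<Longrightarrow> w \<in> set (butlast p)"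
  by (cases p rule: rev_cases) auto

lemma path_in_mono: "path_in R p \<Longrightarrow> R \<subseteq> R' \<Longrightarrow> path_in R' p"
  by (auto simp: path_in_def elim!: successively_mono)

text \<open>A vertex of each part is prepended by induction; the condition on \<open>hd p\<close>
  lets the new vertex of \<open>Q\<close> be joined to the old path.\<close>

lemma complete_bipartite_path:
  assumes "finite P" "finite Q" "P \<inter> Q = {}" "card P = card Q"
  shows "\<exists>p. path_in (P \<times> Q \<union> Q \<times> P) p \<and> set p = P \<union> Q \<and> (p \<noteq> [] \<longrightarrow> hd p \<in> P)"
  using assms
proof (induction P arbitrary: Q)
  case empty
  then show ?case by (auto intro!: exI[of _ "[]"] simp: path_in_Nil)
next
  case (insert x P)
  then obtain y Q' where Q: "Q = insert y Q'" "y \<notin> Q'" "card P = card Q'"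
    by (metis card_Suc_eq card_insert_disjoint)
  then obtain p where p: "path_in (P \<times> Q' \<union> Q' \<times> P) p" "set p = P \<union> Q'" "p \<noteq> [] \<longrightarrow> hd p \<in> P"
    using insert by (metis Int_insert_left Int_insert_right finite_insert insert_not_empty)
  have "path_in (insert x P \<times> Q \<union> Q \<times> insert x P) p"
    using p(1) Q by (auto elim!: path_in_mono)
  then have "path_in (insert x P \<times> Q \<union> Q \<times> insert x P) (x # y # p)"
    using p Q insert by (auto simp: path_in_Cons)
  then show ?case using p Q by (intro exI[of _ "x # y # p"]) auto
qed

text \<open>\<open>P\<close> and \<open>Q\<close> play symmetric roles, so every fact may be used with the parts exchanged.\<close>

locale balanced_relation =
  fixes R :: "('a \<times> 'a) set" and P Q :: "'a set"
  assumes fin: "finite P" "finite Q" and disj: "P \<inter> Q = {}"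
    and sub: "R \<subseteq> P \<times> Q \<union> Q \<times> P" and sym: "sym R" and bal: "card P = card Q"
begin

lemma swap: "balanced_relation R Q P"
  by unfold_locales (use fin disj sub sym bal in auto)

lemma symD: "(u, v) \<in> R \<Longrightarrow> (v, u) \<in> R"
  using sym by (auto dest: Relation.symD)

lemma nbr_P: "(u, v) \<in> R \<Longrightarrow> u \<in> P \<Longrightarrow> v \<in> Q"
  and nbr_Q: "(u, v) \<in> R \<Longrightarrow> u \<in> Q \<Longrightarrow> v \<in> P"
  using sub disj by auto

lemma fin_nbrs: "finite (R `` S)"
  by (rule finite_subset[of _ "P \<union> Q"]) (use fin sub in auto)

lemma irrefl: "(u, u) \<notin> R"
  using sub disj by auto

lemmas rev_path = path_in_rev[OF sym]

definition traced :: bool where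
  "traced \<longleftrightarrow> (\<exists>p. path_in R p \<and> set p = P \<union> Q)"

lemma not_tracedD: "\<not> traced \<Longrightarrow> set p = P \<union> Q \<Longrightarrow> \<not> path_in R p"
  by (auto simp: traced_def)

definition two_paths :: "'a list \<Rightarrow> 'a list \<Rightarrow> bool" where
  "two_paths A B \<longleftrightarrow> A \<noteq> [] \<and> B \<noteq> [] \<and> path_in R A \<and> path_in R B
     \<and> set A \<inter> set B = {} \<and> set A \<union> set B = P \<union> Q"

lemma two_paths_rev: "two_paths A B \<longleftrightarrow> two_paths (rev B) (rev A)"
  by (auto simp: two_paths_def rev_path)

lemma two_paths_commute: "two_paths A B \<longleftrightarrow> two_paths B A"
  by (auto simp: two_paths_def)

text \<open>Such an edge would glue the two pieces, one of them reversed if necessary, to a Hamilton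
  path.\<close>

lemma join_paths:
  assumes "\<not> traced" "two_paths A B"
  shows "(last A, hd B) \<notin> R" "(last A, last B) \<notin> R" "(hd A, hd B) \<notin> R" "(last B, hd A) \<notin> R"
proof -
  have "\<not> path_in R (A @ B)" "\<not> path_in R (A @ rev B)" "\<not> path_in R (rev A @ B)" "\<not> path_in R (B @ A)"
    using assms(2) by (intro not_tracedD[OF assms(1)]; auto simp: two_paths_def)+
  with assms show "(last A, hd B) \<notin> R" "(last A, last B) \<notin> R" "(hd A, hd B) \<notin> R" "(last B, hd A) \<notin> R"
    by (auto simp: path_in_append rev_path two_paths_def hd_rev last_rev dest: symD)
qed

text \<open>Ore's crossing argument: in the Hamilton path with the gap between \<open>last A\<close> and \<open>hd B\<close>
  bridged, the successor of a neighbour of \<open>last A\<close> is not a neighbour of \<open>hd B\<close>.\<close>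

lemma degree_sum_gap:
  assumes nt: "\<not> traced" and AB: "two_paths A B" and last_A: "last A \<in> P" and hd_B: "hd B \<in> Q"
  shows "card (R `` {last A}) + card (R `` {hd B}) \<le> card P"
    and "hd A \<in> P \<Longrightarrow> card (R `` {last A}) + card (R `` {hd B}) < card P"
proof -
  define u v where uv: "u = last A" "v = hd B"
  have u: "u \<in> P" and v: "v \<in> Q" using last_A hd_B by (simp_all add: uv)
  let ?p = "A @ B"
  have ne: "A \<noteq> []" "B \<noteq> []" and paths: "path_in R A" "path_in R B"
    and dj: "set A \<inter> set B = {}" and cover: "set A \<union> set B = P \<union> Q"
    using AB by (auto simp: two_paths_def)
  have dist: "distinct ?p" using paths dj by (auto simp: path_in_def)
  obtain s where s: "\<And>C w z D. ?p = C @ w # z # D \<Longrightarrow> s w = z" "inj_on s (set (butlast ?p))"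
    using distinct_list_successor[OF dist] by blast
  note join = join_paths[OF nt AB, folded uv]
  \<comment> \<open>Along \<open>A @ B\<close> the successor of a neighbour of \<open>u\<close> is
    back in \<open>P\<close>. It cannot be the first vertex \<open>hd A\<close>, and the two cases
    below show that it is not adjacent to \<open>v\<close>.\<close>
  have nbr: "w \<in> set (butlast ?p) \<and> s w \<in> P - R `` {v} - {hd A}" if w: "(u, w) \<in> R" for w
  proof -
    have wQ: "w \<in> Q" using nbr_P[OF w u] .
    have wp: "w \<in> set ?p" using wQ cover by auto
    have wu: "w \<noteq> u" using w irrefl by metis
    have "w \<noteq> last ?p" using w join(2) ne by auto
    then obtain C z D where p: "?p = C @ w # z # D" using split_before[OF wp] by metis
    have sw: "s w = z" by (rule s(1)[OF p])
    have "z \<noteq> hd A"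
    proof
      assume "z = hd A"
      then have "hd ?p = z" using ne by simp
      with dist p show False by (cases C) auto
    qed
    moreover have "z \<in> P \<and> (v, z) \<notin> R"
    proof -
      from p have "A @ B = (C @ [w]) @ (z # D)" by simp
      then consider us where "A @ us = C @ [w]" "B = us @ z # D"
        | us where "A = (C @ [w]) @ us" "us @ B = z # D"
        unfolding append_eq_append_conv2 by blast
      then show ?thesis
      proof cases
        \<comment> \<open>Here \<open>w\<close> lies in \<open>B\<close>. If \<open>v\<close> and
          \<open>z\<close> were adjacent, a Hamilton path would run through \<open>A\<close> to
          \<open>u\<close>, jump to \<open>w\<close>, go back along \<open>us\<close> to
          \<open>v\<close>, and continue from \<open>z\<close>.\<close>
        case 1
        have us: "us \<noteq> []" "last us = w" "hd us = v"
        proof -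
          have l: "last (A @ us) = w" by (simp add: 1(1))
          then show us: "us \<noteq> []" using wu by (auto simp: uv)
          show "last us = w" using l us by simp
          show "hd us = v" using us by (simp add: uv 1(2))
        qed
        have p2: "path_in R us" "path_in R (z # D)" "(w, z) \<in> R" "set us \<inter> set (z # D) = {}"
          using paths(2) us unfolding 1(2) path_in_append by auto
        have "\<not> path_in R (A @ rev us @ z # D)"
          by (rule not_tracedD[OF nt]) (use 1(2) in \<open>auto simp flip: cover\<close>)
        then have "(v, z) \<notin> R"
          unfolding path_in_append rev_path using p2 us w paths(1) dj[unfolded 1(2)] uv(1)
          by (auto simp: hd_rev last_rev)
        then show ?thesis using nbr_Q[OF p2(3) wQ] by blast
      next
        \<comment> \<open>Here \<open>w\<close> lies in \<open>A\<close>. If \<open>z\<close> and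
          \<open>v\<close> were adjacent, a Hamilton path would run up to \<open>w\<close>, jump to
          \<open>u\<close>, go back along \<open>us\<close> to \<open>z\<close>, and jump to
          \<open>v\<close> to finish with \<open>B\<close>.\<close>
        case 2
        have us: "us \<noteq> []" "last us = u" "hd us = z"
        proof -
          show us: "us \<noteq> []" using 2(1) wu by (auto simp: uv)
          show "last us = u" using us by (simp add: uv 2(1))
          have "hd (us @ B) = z" by (simp add: 2(2))
          with us show "hd us = z" by simp
        qed
        have p2: "path_in R (C @ [w])" "path_in R us" "(w, z) \<in> R" "set (C @ [w]) \<inter> set us = {}"
          using paths(1) us unfolding 2(1) path_in_append by auto
        have "\<not> path_in R ((C @ [w]) @ rev us @ B)"
          by (rule not_tracedD[OF nt]) (use 2(1) in \<open>auto simp flip: cover\<close>)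
        then have "(z, v) \<notin> R"
          unfolding path_in_append[of _ _ "rev us @ B"] path_in_append[of _ "rev us"] rev_path
          using p2 us symD[OF w] paths(2) dj[unfolded 2(1)] ne(2) uv(2)
          by (auto simp: hd_rev last_rev)
        then show ?thesis using nbr_Q[OF p2(3) wQ] symD by blast
      qed
    qed
    ultimately show ?thesis
      using sw in_set_butlast_if_not_last[OF wp \<open>w \<noteq> last ?p\<close>] by simp
  qed
  have "card (R `` {u}) = card (s ` R `` {u})"
    by (intro card_image[symmetric] inj_on_subset[OF s(2)] subsetI) (use nbr in blast)
  also have "\<dots> \<le> card (P - R `` {v} - {hd A})"
    by (intro card_mono image_subsetI) (use nbr fin in auto)
  finally have main: "card (R `` {u}) \<le> card (P - R `` {v} - {hd A})" .
  have sub_P: "R `` {v} \<subseteq> P" using v nbr_Q by auto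
  have "card (P - R `` {v}) = card P - card (R `` {v})"
    by (rule card_Diff_subset[OF fin_nbrs sub_P])
  moreover have "card (R `` {v}) \<le> card P" using sub_P fin card_mono by blast
  moreover have "card (P - R `` {v} - {hd A}) \<le> card (P - R `` {v})"
    using fin by (intro card_mono) auto
  ultimately show "card (R `` {last A}) + card (R `` {hd B}) \<le> card P"
    unfolding uv[symmetric] using main by linarith
  \<comment> \<open>Now \<open>hd A\<close> is a vertex of \<open>P\<close> that is neither a
    neighbour of \<open>v\<close> nor a successor, so the count loses one more.\<close>
  assume "hd A \<in> P"
  then have "hd A \<in> P - R `` {v}" using join(3) symD by auto
  then have "card (P - R `` {v} - {hd A}) < card (P - R `` {v})"
    using fin by (intro psubset_card_mono) auto
  with main \<open>card (P - R `` {v}) = card P - card (R `` {v})\<close> \<open>card (R `` {v}) \<le> card P\<close>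
  show "card (R `` {last A}) + card (R `` {hd B}) < card P"
    unfolding uv[symmetric] by linarith
qed

section \<open>Closing the two pieces into cycles\<close>

text \<open>Two adjacent vertices qualify, so that a block consisting of a single edge is covered; a
  single vertex does not, because \<open>R\<close> has no loops.\<close>

definition spans_cycle :: "'a set \<Rightarrow> bool" where
  "spans_cycle S \<longleftrightarrow> (\<exists>p. path_in R p \<and> p \<noteq> [] \<and> set p = S \<and> (last p, hd p) \<in> R)"

text \<open>If the vertices of \<open>A\<close> spanned no cycle, send each neighbour of
  \<open>last A\<close> to its successor in \<open>A\<close> or to its predecessor in
  \<open>B\<close>. No value is adjacent to \<open>hd A\<close>, and \<open>last B\<close> is
  neither a value nor adjacent to \<open>hd A\<close>, so the degree sum falls below
  \<open>card P\<close>.\<close>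

lemma path_closes:
  assumes nt: "\<not> traced" and AB: "two_paths A B"
    and ends: "hd A \<in> P" "last A \<in> Q" "last B \<in> Q"
    and deg: "(hd A, last A) \<notin> R \<Longrightarrow> card P \<le> card (R `` {hd A}) + card (R `` {last A})"
  shows "spans_cycle (set A)"
proof (rule ccontr)
  assume nc: "\<not> spans_cycle (set A)"
  define a u b where aub: "a = hd A" "u = last A" "b = last B"
  have a: "a \<in> P" and u: "u \<in> Q" and b: "b \<in> Q" using ends by (simp_all add: aub)
  have ne: "A \<noteq> []" "B \<noteq> []" and paths: "path_in R A" "path_in R B"
    and dj: "set A \<inter> set B = {}" and cover: "set A \<union> set B = P \<union> Q"
    using AB by (auto simp: two_paths_def)
  have dist: "distinct A" "distinct B" using paths by (auto simp: path_in_def)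
  note join = join_paths[OF nt AB, folded aub]
  have au: "(a, u) \<notin> R" using nc ne paths symD unfolding spans_cycle_def aub by blast
  obtain s where s: "\<And>C w z D. A = C @ w # z # D \<Longrightarrow> s w = z" "inj_on s (set (butlast A))"
    using distinct_list_successor[OF dist(1)] by blast
  \<comment> \<open>Reversing \<open>B\<close> turns successors into predecessors.\<close>
  obtain t where t: "\<And>C w z D. rev B = C @ w # z # D \<Longrightarrow> t w = z"
      "inj_on t (set (butlast (rev B)))"
    using distinct_list_successor[of "rev B"] dist(2) by auto
  have in_A: "w \<in> set (butlast A) \<and> s w \<in> set A \<and> s w \<in> Q - R `` {a} - {b}"
    if w: "(u, w) \<in> R" "w \<in> set A" for w
  proof -
    have wP: "w \<in> P" using nbr_Q[OF w(1) u] .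
    have wu: "w \<noteq> u" using w irrefl by metis
    then obtain C z D where p: "A = C @ w # z # D" using split_before[OF w(2)] unfolding aub by metis
    have sw: "s w = z" by (rule s(1)[OF p])
    have A: "A = (C @ [w]) @ (z # D)" using p by simp
    have p2: "path_in R (C @ [w])" "path_in R (z # D)" "(w, z) \<in> R"
      "set (C @ [w]) \<inter> set (z # D) = {}"
      using paths(1) unfolding A path_in_append by auto
    have "last (z # D) = u" using p by (simp add: aub)
    \<comment> \<open>Crossing inside \<open>A\<close>: up to \<open>w\<close>, over to
      \<open>u\<close>, and back to \<open>z\<close>. An edge from \<open>z\<close> to
      \<open>a\<close> would close this path to a cycle on the vertices of \<open>A\<close>.\<close>
    then have "path_in R ((C @ [w]) @ rev (z # D))"
      unfolding path_in_append[of _ "C @ [w]"] using p2 symD[OF w(1)]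
      by (auto simp: rev_path hd_rev simp del: rev.simps)
    moreover have "set ((C @ [w]) @ rev (z # D)) = set A" using A by auto
    moreover have "hd ((C @ [w]) @ rev (z # D)) = a" using p by (cases C) (auto simp: aub)
    moreover have "last ((C @ [w]) @ rev (z # D)) = z" by simp
    ultimately have "(z, a) \<notin> R" using nc unfolding spans_cycle_def by fastforce
    then have "(a, z) \<notin> R" using symD by blast
    moreover have "z \<in> Q" using nbr_P[OF p2(3) wP] .
    moreover have "z \<in> set A" using p by simp
    moreover have "z \<noteq> b" using \<open>z \<in> set A\<close> dj ne by (auto simp: aub)
    ultimately show ?thesis using sw in_set_butlast_if_not_last[OF w(2)] wu by (simp add: aub)
  qed
  have in_B: "w \<in> set (butlast (rev B)) \<and> t w \<in> set B \<and> t w \<in> Q - R `` {a} - {b}"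
    if w: "(u, w) \<in> R" "w \<in> set B" for w
  proof -
    have wP: "w \<in> P" using nbr_Q[OF w(1) u] .
    have wv: "w \<noteq> hd B" using w join(1) by metis
    then obtain C z D where p: "B = C @ z # w # D" using split_after[OF w(2)] by metis
    have tw: "t w = z" by (rule t(1)[of "rev D" _ _ "rev C"]) (simp add: p)
    have B: "B = (C @ [z]) @ (w # D)" using p by simp
    have p2: "path_in R (C @ [z])" "path_in R (w # D)" "(z, w) \<in> R"
      "set (C @ [z]) \<inter> set (w # D) = {}"
      using paths(2) unfolding B path_in_append by auto
    \<comment> \<open>With edges from \<open>z\<close> to \<open>a\<close> and from \<open>u\<close>
      to \<open>w\<close>, all of \<open>A\<close> could be inserted between the consecutive
      vertices \<open>z\<close> and \<open>w\<close> of \<open>B\<close>.\<close>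
    have "\<not> path_in R ((C @ [z]) @ A @ (w # D))"
      by (rule not_tracedD[OF nt]) (use B in \<open>auto simp flip: cover\<close>)
    then have "(z, a) \<notin> R"
      unfolding path_in_append[of _ "C @ [z]"] path_in_append[of _ A]
      using p2 w(1) paths(1) dj[unfolded B] ne(1) aub by auto
    then have "(a, z) \<notin> R" using symD by blast
    moreover have "z \<in> Q" using nbr_P[OF symD[OF p2(3)] wP] .
    moreover have "z \<in> set B" using p by simp
    moreover have "z \<noteq> b" using p dist(2) by (auto simp: aub)
    moreover have "w \<in> set (butlast (rev B))"
      using in_set_butlast_if_not_last[of w "rev B"] w(2) wv ne by (simp add: last_rev)
    ultimately show ?thesis using tw by simp
  qed
  define r where "r w = (if w \<in> set A then s w else t w)" for w
  have nbrs: "R `` {u} \<subseteq> set A \<union> set B" using cover u nbr_Q by auto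
  have maps: "r ` R `` {u} \<subseteq> Q - R `` {a} - {b}"
  proof (rule image_subsetI)
    fix w assume "w \<in> R `` {u}"
    then have w: "(u, w) \<in> R" "w \<in> set A \<or> w \<in> set B" using nbrs by auto
    show "r w \<in> Q - R `` {a} - {b}"
      using in_A[OF w(1)] in_B[OF w(1)] w(2) unfolding r_def by presburger
  qed
  have "inj_on r (R `` {u})"
  proof (rule inj_onI)
    fix w w' assume w: "w \<in> R `` {u}" "w' \<in> R `` {u}" and eq: "r w = r w'"
    \<comment> \<open>Successors stay in \<open>A\<close> and predecessors in \<open>B\<close>, so
      injectivity may be checked on the two pieces separately.\<close>
    have part: "r x \<in> set A \<longleftrightarrow> x \<in> set A" if "x \<in> R `` {u}" for x
    proof -
      have x: "(u, x) \<in> R" "x \<in> set A \<or> x \<in> set B" using that nbrs by auto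
      then show ?thesis
        using in_A[OF x(1)] in_B[OF x(1)] dj unfolding r_def by (metis disjoint_iff)
    qed
    show "w = w'"
    proof (cases "w \<in> set A")
      case True
      then have "w' \<in> set A" using part[OF w(1)] part[OF w(2)] eq by simp
      with True show ?thesis
        using w eq in_A inj_onD[OF s(2)] by (auto simp: r_def)
    next
      case False
      then have w': "w' \<notin> set A" using part[OF w(1)] part[OF w(2)] eq by simp
      then have "w \<in> set B" "w' \<in> set B" using False w nbrs by auto
      with False w' show ?thesis
        using w eq in_B inj_onD[OF t(2)] by (auto simp: r_def)
    qed
  qed
  then have "card (R `` {u}) = card (r ` R `` {u})" by (simp add: card_image)
  also have "\<dots> \<le> card (Q - R `` {a} - {b})"
    using maps fin by (intro card_mono) auto
  \<comment> \<open>An edge from \<open>b\<close> to \<open>a\<close> would join the two pieces, so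
    \<open>b\<close> is one more non-neighbour of \<open>a\<close>; removing it makes the inequality
    strict.\<close>
  also have "\<dots> < card (Q - R `` {a})"
    using join(4) b fin symD by (intro psubset_card_mono) auto
  also have "\<dots> = card Q - card (R `` {a})"
    using a nbr_P by (intro card_Diff_subset fin_nbrs) auto
  finally show False using deg[folded aub, OF au] bal by linarith
qed

text \<open>Opening both cycles at the ends of such an edge and gluing along it would give a
  Hamilton path.\<close>

lemma no_edge_between_cycles:
  assumes nt: "\<not> traced" and S: "spans_cycle S" and T: "spans_cycle T"
    and dj: "S \<inter> T = {}" and cover: "S \<union> T = P \<union> Q" and w: "w \<in> S" and z: "z \<in> T"
  shows "(w, z) \<notin> R"
proof
  assume e: "(w, z) \<in> R"
  have end_at: "\<exists>p. path_in R p \<and> p \<noteq> [] \<and> set p = U \<and> last p = x"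
    if U: "spans_cycle U" and x: "x \<in> U" for U x
  proof -
    obtain p where p: "path_in R p" "p \<noteq> []" "set p = U" "(last p, hd p) \<in> R"
      using U unfolding spans_cycle_def by blast
    obtain C D where CD: "p = (C @ [x]) @ D" using x p(3) split_list[of x p] by auto
    \<comment> \<open>Rotation of the cycle: its closing edge from \<open>last p\<close> to
      \<open>hd p\<close> joins \<open>D\<close> to \<open>C @ [x]\<close>, unless \<open>D\<close>
      is empty and \<open>x\<close> is last already.\<close>
    have "path_in R (D @ C @ [x])"
      using p(1,4) unfolding CD path_in_append[of _ _ D] path_in_append[of _ D]
      by (cases "D = []") (auto simp: hd_append)
    moreover have "set (D @ C @ [x]) = U" using p(3) CD by auto
    ultimately show ?thesis by (intro exI[of _ "D @ C @ [x]"]) auto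
  qed
  obtain p where p: "path_in R p" "p \<noteq> []" "set p = S" "last p = w"
    using end_at[OF S w] by blast
  obtain q where q: "path_in R q" "q \<noteq> []" "set q = T" "last q = z"
    using end_at[OF T z] by blast
  have "path_in R (p @ rev q)"
    using p q e dj by (auto simp: path_in_append rev_path hd_rev)
  moreover have "set (p @ rev q) = P \<union> Q" using p q cover by auto
  ultimately show False using not_tracedD[OF nt] by blast
qed

section \<open>Two balanced complete bipartite blocks\<close>

lemma complement_nbrs_P:
  assumes "u \<in> P"
  shows "card ((P \<times> Q \<union> Q \<times> P - R) `` {u}) = card P - card (R `` {u})"
    and "card (R `` {u}) \<le> card P"
proof -
  have sub_Q: "R `` {u} \<subseteq> Q" using assms nbr_P by auto
  moreover have "(P \<times> Q \<union> Q \<times> P - R) `` {u} = Q - R `` {u}" using assms disj by auto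
  ultimately show "card ((P \<times> Q \<union> Q \<times> P - R) `` {u}) = card P - card (R `` {u})"
    using bal fin_nbrs by (simp add: card_Diff_subset)
  show "card (R `` {u}) \<le> card P" using sub_Q fin bal by (simp add: card_mono)
qed

text \<open>The structure of \<open>R_graph\<close> without its labels: \<open>S\<close> and
  \<open>T\<close> carry the two components, and neither is empty.\<close>

definition two_blocks :: "'a set \<Rightarrow> 'a set \<Rightarrow> bool" where
  "two_blocks S T \<longleftrightarrow> S \<union> T = P \<union> Q \<and> S \<inter> T = {} \<and> P \<inter> S \<noteq> {} \<and> P \<inter> T \<noteq> {}
     \<and> card (P \<inter> S) = card (Q \<inter> S) \<and> card (P \<inter> T) = card (Q \<inter> T)
     \<and> R = (P \<times> Q \<union> Q \<times> P) \<inter> (S \<times> S \<union> T \<times> T)"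

interpretation sw: balanced_relation R Q P
  by (rule swap)

lemma traced_swap: "sw.traced \<longleftrightarrow> traced"
  by (simp add: traced_def sw.traced_def Un_commute)

lemma two_paths_swap: "sw.two_paths A B \<longleftrightarrow> two_paths A B"
  by (simp add: two_paths_def sw.two_paths_def Un_commute)

text \<open>No edge joins \<open>S\<close> and \<open>T\<close>, so the neighbours of a vertex lie
  in the opposite side of its own block. The degree condition on pairs from different blocks leaves
  no slack in the resulting bounds.\<close>

lemma two_blocks_if_cycles:
  assumes nt: "\<not> traced" and cyc: "spans_cycle S" "spans_cycle T"
    and dj: "S \<inter> T = {}" and cover: "S \<union> T = P \<union> Q"
    and ends: "P \<inter> S \<noteq> {}" "P \<inter> T \<noteq> {}" "Q \<inter> S \<noteq> {}" "Q \<inter> T \<noteq> {}"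
    and deg: "\<And>u v. u \<in> P \<Longrightarrow> v \<in> Q \<Longrightarrow> (u, v) \<notin> R \<Longrightarrow> card P \<le> card (R `` {u}) + card (R `` {v})"
  shows "two_blocks S T"
proof -
  have no: "(w, z) \<notin> R" "(z, w) \<notin> R" if "w \<in> S" "z \<in> T" for w z
    using no_edge_between_cycles[OF nt cyc dj cover that] symD by blast+
  have nbrs: "w \<in> P \<Longrightarrow> w \<in> S \<Longrightarrow> R `` {w} \<subseteq> Q \<inter> S" "w \<in> P \<Longrightarrow> w \<in> T \<Longrightarrow> R `` {w} \<subseteq> Q \<inter> T"
    "w \<in> Q \<Longrightarrow> w \<in> S \<Longrightarrow> R `` {w} \<subseteq> P \<inter> S" "w \<in> Q \<Longrightarrow> w \<in> T \<Longrightarrow> R `` {w} \<subseteq> P \<inter> T" for w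
    using no cover nbr_P nbr_Q by blast+
  have le: "w \<in> P \<Longrightarrow> w \<in> S \<Longrightarrow> card (R `` {w}) \<le> card (Q \<inter> S)"
    "w \<in> P \<Longrightarrow> w \<in> T \<Longrightarrow> card (R `` {w}) \<le> card (Q \<inter> T)"
    "w \<in> Q \<Longrightarrow> w \<in> S \<Longrightarrow> card (R `` {w}) \<le> card (P \<inter> S)"
    "w \<in> Q \<Longrightarrow> w \<in> T \<Longrightarrow> card (R `` {w}) \<le> card (P \<inter> T)" for w
    using nbrs fin by (simp_all add: card_mono)
  obtain p p' q q' where pq: "p \<in> P" "p \<in> S" "p' \<in> P" "p' \<in> T" "q \<in> Q" "q \<in> S" "q' \<in> Q" "q' \<in> T"
    using ends by blast
  have split: "card U = card (U \<inter> S) + card (U \<inter> T)" if "U \<subseteq> P \<union> Q" for U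
  proof -
    have "U = (U \<inter> S) \<union> (U \<inter> T)" using that cover by blast
    moreover have "finite U" using that fin finite_subset by blast
    ultimately show ?thesis using dj card_Un_disjoint[of "U \<inter> S" "U \<inter> T"] by fastforce
  qed
  \<comment> \<open>These two missing edges give
    \<open>card (P \<inter> S) \<le> card (Q \<inter> S)\<close> and the same for \<open>T\<close>;
    as \<open>P\<close> and \<open>Q\<close> have equal size, both are equalities.\<close>
  have "card P \<le> card (R `` {p}) + card (R `` {q'})" "card P \<le> card (R `` {p'}) + card (R `` {q})"
    using deg no pq by blast+
  then have bals: "card (P \<inter> S) = card (Q \<inter> S)" "card (P \<inter> T) = card (Q \<inter> T)"
    using le(1)[OF pq(1,2)] le(2)[OF pq(3,4)] le(3)[OF pq(5,6)] le(4)[OF pq(7,8)]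
      split[of P] split[of Q] bal by auto
  have "R `` {w} = Q \<inter> S" if w: "w \<in> P" "w \<in> S" for w
  proof (rule card_subset_eq)
    have "card P \<le> card (R `` {w}) + card (R `` {q'})" using deg no pq w by blast
    then show "card (R `` {w}) = card (Q \<inter> S)"
      using le(1)[OF w] le(4)[OF pq(7,8)] split[of P] bals by auto
  qed (use fin nbrs w in auto)
  moreover have "R `` {w} = Q \<inter> T" if w: "w \<in> P" "w \<in> T" for w
  proof (rule card_subset_eq)
    have "card P \<le> card (R `` {w}) + card (R `` {q})" using deg no pq w by blast
    then show "card (R `` {w}) = card (Q \<inter> T)"
      using le(2)[OF w] le(3)[OF pq(5,6)] split[of P] bals by auto
  qed (use fin nbrs w in auto)
  ultimately have edge: "(w, z) \<in> R \<longleftrightarrow> z \<in> Q \<and> (w \<in> S \<and> z \<in> S \<or> w \<in> T \<and> z \<in> T)" if "w \<in> P" for w z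
    using that cover no by blast
  have "R = (P \<times> Q \<union> Q \<times> P) \<inter> (S \<times> S \<union> T \<times> T)"
  proof (intro Set.set_eqI)
    fix e :: "'a \<times> 'a"
    obtain w z where e: "e = (w, z)" by (cases e)
    show "e \<in> R \<longleftrightarrow> e \<in> (P \<times> Q \<union> Q \<times> P) \<inter> (S \<times> S \<union> T \<times> T)"
      unfolding e using edge[of w z] edge[of z w] symD[of w z] symD[of z w] sub by blast
  qed
  with bals ends dj cover show ?thesis unfolding two_blocks_def by blast
qed

text \<open>The strict form of the gap bound excludes that a piece begins and ends in the same part.
  Thus both pieces run from \<open>Q\<close> to \<open>P\<close>, and both can be closed to
  cycles.\<close>

lemma two_blocks_if_two_paths:
  assumes nt: "\<not> traced" and AB: "two_paths A B" and u: "last A \<in> P" and v: "hd B \<in> Q"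
    and deg: "\<And>u v. u \<in> P \<Longrightarrow> v \<in> Q \<Longrightarrow> (u, v) \<notin> R \<Longrightarrow> card P \<le> card (R `` {u}) + card (R `` {v})"
  shows "two_blocks (set A) (set B)"
proof -
  have ne: "A \<noteq> []" "B \<noteq> []" and dj: "set A \<inter> set B = {}" and cover: "set A \<union> set B = P \<union> Q"
    using AB by (auto simp: two_paths_def)
  have gap: "card P \<le> card (R `` {last A}) + card (R `` {hd B})"
    using deg u v join_paths(1)[OF nt AB] by blast
  have "hd A \<notin> P" using degree_sum_gap(2)[OF nt AB u v] gap by linarith
  moreover have "hd A \<in> P \<union> Q" using ne unfolding cover[symmetric] by simp
  ultimately have a: "hd A \<in> Q" by blast
  have BA: "two_paths B A" using AB two_paths_commute by blast
  \<comment> \<open>Reversal together with an exchange of the parts makes \<open>last B\<close> the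
    initial vertex, so the same bound applies to it.\<close>
  have "sw.two_paths (rev B) (rev A)"
    using AB two_paths_rev two_paths_swap by blast
  from sw.degree_sum_gap(2)[OF _ this] have "last B \<notin> Q"
    using nt u v ne gap bal by (auto simp: traced_swap hd_rev last_rev)
  moreover have "last B \<in> P \<union> Q" using ne unfolding cover[symmetric] by simp
  ultimately have b: "last B \<in> P" by blast
  have deg': "(w, z) \<notin> R \<Longrightarrow> card Q \<le> card (R `` {w}) + card (R `` {z})" if "w \<in> Q" "z \<in> P" for w z
    using deg[OF that(2,1)] symD bal by (metis add.commute)
  have nt': "\<not> sw.traced" using nt traced_swap by simp
  have "spans_cycle (set A)"
    by (rule sw.path_closes[OF nt', of A B]) (use AB a u b deg' two_paths_swap in auto)
  moreover have "spans_cycle (set B)"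
    by (rule sw.path_closes[OF nt', of B A]) (use BA v b u deg' two_paths_swap in auto)
  ultimately show ?thesis
    by (rule two_blocks_if_cycles[OF nt _ _ dj cover _ _ _ _ deg])
      (use a b u v ne in auto)
qed

lemma two_paths_at_nonedge:
  assumes nt: "\<not> traced" and p: "path_in (R \<union> {(u, v), (v, u)}) p" "set p = P \<union> Q"
  obtains A B where "two_paths A B" "last A = u" "hd B = v"
proof -
  from split_at_new_edge[OF p(1) not_tracedD[OF nt p(2)]] obtain A B where
    AB: "p = A @ B" "A \<noteq> []" "B \<noteq> []" "path_in R A" "path_in R B" "{last A, hd B} = {u, v}"
    by blast
  have "distinct p" using p(1) by (simp add: path_in_def)
  then have tp: "two_paths A B" using AB p(2) by (auto simp: two_paths_def)
  from AB(6) consider "last A = u" "hd B = v" | "last A = v" "hd B = u"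
    by (auto simp: doubleton_eq_iff)
  then show thesis
  proof cases
    case 1
    with tp that show thesis by blast
  next
    \<comment> \<open>The new edge is traversed from \<open>v\<close> to \<open>u\<close>; reading
      the path backwards restores the orientation.\<close>
    case 2
    with tp AB that[of "rev B" "rev A"] show thesis
      using two_paths_rev by (simp add: hd_rev last_rev)
  qed
qed

text \<open>A complete balanced bipartite relation has an alternating Hamilton path.\<close>

lemma nonedge_if_not_traced:
  assumes "\<not> traced"
  obtains u v where "u \<in> P" "v \<in> Q" "(u, v) \<notin> R"
proof (rule ccontr)
  assume "\<not> thesis"
  then have "P \<times> Q \<union> Q \<times> P \<subseteq> R" using that symD by blast
  then show False
    using complete_bipartite_path[OF fin disj bal] path_in_mono not_tracedD[OF assms] by metis
qed

end

section \<open>Edge-maximal non-traceable relations\<close>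

text \<open>Only finitely many relations live between \<open>P\<close> and \<open>Q\<close>, so an
  inclusion-maximal untraced one lies above \<open>R\<^sub>0\<close>. Adding a missing edge keeps
  all locale conditions, so by maximality it must create a Hamilton path.\<close>

lemma edge_maximal_untraced:
  assumes "balanced_relation R\<^sub>0 P Q" "\<not> balanced_relation.traced R\<^sub>0 P Q"
  obtains R where "balanced_relation R P Q" "\<not> balanced_relation.traced R P Q" "R\<^sub>0 \<subseteq> R"
    "\<And>u v. u \<in> P \<Longrightarrow> v \<in> Q \<Longrightarrow> (u, v) \<notin> R \<Longrightarrow>
      \<exists>p. path_in (R \<union> {(u, v), (v, u)}) p \<and> set p = P \<union> Q"
proof -
  let ?F = "{R. balanced_relation R P Q \<and> \<not> balanced_relation.traced R P Q}"
  have "finite ?F"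
  proof (rule finite_subset)
    show "?F \<subseteq> Pow (P \<times> Q \<union> Q \<times> P)" using balanced_relation.sub by blast
    show "finite (Pow (P \<times> Q \<union> Q \<times> P))" using balanced_relation.fin[OF assms(1)] by simp
  qed
  moreover have "R\<^sub>0 \<in> ?F" using assms by simp
  ultimately have "\<exists>R\<in>?F. R\<^sub>0 \<subseteq> R \<and> (\<forall>R'\<in>?F. R \<subseteq> R' \<longrightarrow> R = R')"
    by (rule finite_has_maximal2)
  then obtain R where R: "balanced_relation R P Q" "\<not> balanced_relation.traced R P Q" "R\<^sub>0 \<subseteq> R"
    and max: "\<forall>R'\<in>?F. R \<subseteq> R' \<longrightarrow> R = R'"
    by blast
  interpret balanced_relation R P Q by (rule R(1))
  have "\<exists>p. path_in (R \<union> {(u, v), (v, u)}) p \<and> set p = P \<union> Q"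
    if uv: "u \<in> P" "v \<in> Q" "(u, v) \<notin> R" for u v
  proof -
    have "sym (R \<union> {(u, v), (v, u)})" by (rule symI) (use symD in auto)
    then have b: "balanced_relation (R \<union> {(u, v), (v, u)}) P Q"
      using uv fin disj sub bal by unfold_locales auto
    have "R \<noteq> R \<union> {(u, v), (v, u)}" using uv(3) by blast
    then have "balanced_relation.traced (R \<union> {(u, v), (v, u)}) P Q"
    proof (rule contrapos_np)
      assume "\<not> balanced_relation.traced (R \<union> {(u, v), (v, u)}) P Q"
      with b have "R \<union> {(u, v), (v, u)} \<in> ?F" by simp
      from bspec[OF max this] show "R = R \<union> {(u, v), (v, u)}" by blast
    qed
    then show ?thesis
      unfolding balanced_relation.traced_def[OF b] .
  qed
  with R that show thesis by blast
qed

section \<open>Degrees of a subrelation as test function\<close>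

text \<open>The sum of \<open>(f v)\<^sup>2\<close> over the vertices equals the sum of
  \<open>f v\<close> over the arcs of \<open>C'\<close>. Hence \<open>bound\<close> says that a sum
  of nonnegative terms is at most zero, and every term vanishes.\<close>

lemma degree_test_function:
  fixes C C' :: "('a \<times> 'a) set" and n :: real
  defines "f \<equiv> \<lambda>v. real (card (C' `` {v}))"
  assumes fin: "finite V" "finite C" and C': "C' \<subseteq> C" "C' \<subseteq> V \<times> V"
    and bound: "(\<Sum>(v, w)\<in>C. (f v + f w) * f v) \<le> n * (\<Sum>v\<in>V. (f v)\<^sup>2)"
    and ge: "\<And>v w. (v, w) \<in> C' \<Longrightarrow> n \<le> f v + f w"
  shows "(v, w) \<in> C' \<Longrightarrow> f v + f w = n" and "(v, w) \<in> C - C' \<Longrightarrow> f v = 0"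
proof -
  have f_nonneg: "f v \<ge> 0" for v by (simp add: f_def)
  have finC': "finite C'" using fin(2) C'(1) finite_subset by blast
  have C'_eq: "C' = (SIGMA v:V. C' `` {v})" using C'(2) by auto
  have "(\<Sum>(v, w)\<in>C'. f v) = (\<Sum>(v, w)\<in>(SIGMA v:V. C' `` {v}). f v)"
    by (rule sum.cong[OF C'_eq refl])
  also have "\<dots> = (\<Sum>v\<in>V. \<Sum>w\<in>C' `` {v}. f v)"
    by (rule sum.Sigma[symmetric]) (use fin finC' in auto)
  also have "\<dots> = (\<Sum>v\<in>V. (f v)\<^sup>2)"
    by (simp add: f_def power2_eq_square)
  finally have squares: "(\<Sum>v\<in>V. (f v)\<^sup>2) = (\<Sum>(v, w)\<in>C'. f v)" by simp
  have "(\<Sum>(v, w)\<in>C. (f v + f w) * f v)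
      = (\<Sum>(v, w)\<in>C - C'. (f v + f w) * f v) + (\<Sum>(v, w)\<in>C'. (f v + f w) * f v)"
    by (rule sum.subset_diff[OF C'(1) fin(2)])
  moreover have "(\<Sum>(v, w)\<in>C'. (f v + f w) * f v)
      = (\<Sum>(v, w)\<in>C'. (f v + f w - n) * f v) + n * (\<Sum>(v, w)\<in>C'. f v)"
    unfolding sum_distrib_left sum.distrib[symmetric]
    by (intro sum.cong) (auto simp: algebra_simps)
  ultimately have le: "(\<Sum>(v, w)\<in>C - C'. (f v + f w) * f v) + (\<Sum>(v, w)\<in>C'. (f v + f w - n) * f v) \<le> 0"
    using bound squares by simp
  have nn1: "0 \<le> (case e of (v, w) \<Rightarrow> (f v + f w) * f v)" for e
    using f_nonneg by (auto split: prod.split)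
  have nn2: "0 \<le> (case e of (v, w) \<Rightarrow> (f v + f w - n) * f v)" if "e \<in> C'" for e
    using f_nonneg ge that by (auto split: prod.split intro!: mult_nonneg_nonneg)
  have "(\<Sum>(v, w)\<in>C - C'. (f v + f w) * f v) \<ge> 0" "(\<Sum>(v, w)\<in>C'. (f v + f w - n) * f v) \<ge> 0"
    using nn1 nn2 by (blast intro: sum_nonneg)+
  with le have sums: "(\<Sum>(v, w)\<in>C - C'. (f v + f w) * f v) = 0" "(\<Sum>(v, w)\<in>C'. (f v + f w - n) * f v) = 0"
    by linarith+
  have zero: "\<forall>e\<in>C - C'. (case e of (v, w) \<Rightarrow> (f v + f w) * f v) = 0"
    "\<forall>e\<in>C'. (case e of (v, w) \<Rightarrow> (f v + f w - n) * f v) = 0"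
    using iffD1[OF sum_nonneg_eq_0_iff[OF finite_Diff[OF fin(2)] nn1] sums(1)]
      iffD1[OF sum_nonneg_eq_0_iff[OF finC' nn2] sums(2)] by blast+
  {
    assume e: "(v, w) \<in> C'"
    then have "C' `` {v} \<noteq> {}" "finite (C' `` {v})" using finC' by auto
    then have "f v > 0" by (simp add: f_def card_gt_0_iff)
    moreover have "(f v + f w - n) * f v = 0" using bspec[OF zero(2) e] by simp
    ultimately show "f v + f w = n" by simp
  }
  assume "(v, w) \<in> C - C'"
  from bspec[OF zero(1) this] have "(f v + f w) * f v = 0" by simp
  with f_nonneg[of v] f_nonneg[of w] show "f v = 0"
    by (auto simp: add_nonneg_eq_0_iff)
qed

section \<open>The extremal graphs\<close>

lemma enumerate_initial_block:
  assumes "finite X" "X = X1 \<union> X2" "X1 \<inter> X2 = {}" "card X1 = k" "card X = n"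
  obtains h where "bij_betw h X {..<n}" "\<And>x. x \<in> X \<Longrightarrow> h x < k \<longleftrightarrow> x \<in> X1"
proof -
  have fin: "finite X1" "finite X2" using assms by auto
  then have card: "card X1 + card X2 = n" using assms by (metis card_Un_disjoint)
  obtain h1 where h1: "bij_betw h1 X1 {..<k}"
    using finite_same_card_bij[of X1 "{..<k}"] fin assms by auto
  obtain h2 where h2: "bij_betw h2 X2 {k..<n}"
    using finite_same_card_bij[of X2 "{k..<n}"] fin assms(4) card by auto
  let ?h = "\<lambda>x. if x \<in> X1 then h1 x else h2 x"
  have "bij_betw ?h X1 {..<k}" using h1 by (simp cong: bij_betw_cong)
  moreover have "bij_betw ?h X2 {k..<n}"
    using h2 assms(3) by (subst bij_betw_cong[of _ _ h2]) auto
  moreover have "{..<k} \<union> {k..<n} = {..<n}" using card assms(4) by auto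
  moreover have "{..<k} \<inter> {k..<n} = {}" by auto
  ultimately have "bij_betw ?h X {..<n}"
    using bij_betw_combine[of ?h X1 "{..<k}" X2 "{k..<n}"] assms(2) by presburger
  moreover have "?h x < k \<longleftrightarrow> x \<in> X1" if "x \<in> X" for x
  proof (cases "x \<in> X1")
    case True
    then show ?thesis using bij_betwE[OF h1] by auto
  next
    case False
    then have "x \<in> X2" using that assms(2) by blast
    then have "h2 x \<in> {k..<n}" using bij_betwE[OF h2] by blast
    with False show ?thesis by simp
  qed
  ultimately show thesis by (rule that)
qed

text \<open>Numbering each part so that \<open>S\<close> occupies the first \<open>k\<close> places
  turns adjacency in both graphs into the same condition: opposite parts and the same side of
  \<open>k\<close>. The assumption \<open>le\<close> yields \<open>k \<le> n div 2\<close>.\<close>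

lemma bipartite_iso_R_graph:
  assumes bip: "balanced_relation (parcs G) X Y" and verts: "pverts G = X \<union> Y" and n: "card X = n"
    and blocks: "balanced_relation.two_blocks (parcs G) X Y S T" and le: "card (X \<inter> S) \<le> card (X \<inter> T)"
  shows "\<exists>k \<in> {1..n div 2}. bipartite_iso G X Y (R_graph n k) (left_part n) (right_part n)"
proof -
  interpret balanced_relation "parcs G" X Y by fact
  define k where "k = card (X \<inter> S)"
  have cover: "S \<union> T = X \<union> Y" and dj: "S \<inter> T = {}" and ne: "X \<inter> S \<noteq> {}"
    and card_Y: "card (Y \<inter> S) = k"
    and arcs: "parcs G = (X \<times> Y \<union> Y \<times> X) \<inter> (S \<times> S \<union> T \<times> T)"
    using blocks unfolding two_blocks_def k_def by auto
  have X: "X = (X \<inter> S) \<union> (X \<inter> T)" "(X \<inter> S) \<inter> (X \<inter> T) = {}"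
    and Y: "Y = (Y \<inter> S) \<union> (Y \<inter> T)" "(Y \<inter> S) \<inter> (Y \<inter> T) = {}"
    using cover dj by blast+
  have "card X = card (X \<inter> S) + card (X \<inter> T)"
    using card_Un_disjoint[OF _ _ X(2)] X(1) fin by simp
  moreover have "k > 0" using ne fin by (simp add: k_def card_gt_0_iff)
  ultimately have k: "k \<in> {1..n div 2}" using le n by (auto simp: k_def)
  then have kn: "k \<le> n" by auto
  obtain hx where hx: "bij_betw hx X {..<n}" "\<And>x. x \<in> X \<Longrightarrow> hx x < k \<longleftrightarrow> x \<in> X \<inter> S"
    using enumerate_initial_block[OF fin(1) X k_def[symmetric] n] by blast
  obtain hy where hy: "bij_betw hy Y {..<n}" "\<And>x. x \<in> Y \<Longrightarrow> hy x < k \<longleftrightarrow> x \<in> Y \<inter> S"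
    using enumerate_initial_block[OF fin(2) Y card_Y bal[symmetric, unfolded n]] by blast
  define \<phi> where "\<phi> v = (if v \<in> X then Inl (hx v) else Inr (hy v))" for v
  have \<phi>: "v \<in> X \<Longrightarrow> \<phi> v = Inl (hx v)" "v \<in> Y \<Longrightarrow> \<phi> v = Inr (hy v)" for v
    using disj by (auto simp: \<phi>_def)
  have bX: "bij_betw \<phi> X (left_part n)"
  proof (subst bij_betw_cong[of _ _ "Inl \<circ> hx"])
    show "bij_betw (Inl \<circ> hx) X (left_part n)"
      unfolding left_part_def by (rule bij_betw_trans[OF hx(1)]) (auto intro: inj_on_imp_bij_betw)
  qed (simp add: \<phi>)
  have bY: "bij_betw \<phi> Y (right_part n)"
  proof (subst bij_betw_cong[of _ _ "Inr \<circ> hy"])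
    show "bij_betw (Inr \<circ> hy) Y (right_part n)"
      unfolding right_part_def by (rule bij_betw_trans[OF hy(1)]) (auto intro: inj_on_imp_bij_betw)
  qed (simp add: \<phi>)
  have "{..<n} = {..<k} \<union> {k..<n}" using kn by auto
  then have "pverts (R_graph n k) = left_part n \<union> right_part n"
    by (auto simp: R_graph_def pair_union_def complete_bipartite_def left_part_def right_part_def)
  moreover have "bij_betw \<phi> (X \<union> Y) (left_part n \<union> right_part n)"
    by (rule bij_betw_combine[OF bX bY]) (auto simp: left_part_def right_part_def)
  ultimately have "bij_betw \<phi> (pverts G) (pverts (R_graph n k))" by (simp add: verts)
  moreover have "(u, v) \<in> parcs G \<longleftrightarrow> (\<phi> u, \<phi> v) \<in> parcs (R_graph n k)"
    if uv: "u \<in> X \<union> Y" "v \<in> X \<union> Y" for u v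
  proof -
    have R: "(p, q) \<in> parcs (R_graph n k) \<longleftrightarrow>
        (case (p, q) of (Inl i, Inr j) \<Rightarrow> i < n \<and> j < n \<and> (i < k \<longleftrightarrow> j < k)
          | (Inr i, Inl j) \<Rightarrow> i < n \<and> j < n \<and> (i < k \<longleftrightarrow> j < k) | _ \<Rightarrow> False)" for p q
      using kn by (auto simp: R_graph_def pair_union_def complete_bipartite_def split: sum.split)
    have lt: "x \<in> X \<Longrightarrow> hx x < n" "y \<in> Y \<Longrightarrow> hy y < n" for x y
      using bij_betwE[OF hx(1)] bij_betwE[OF hy(1)] by auto
    have G: "(u, v) \<in> parcs G \<longleftrightarrow> (u \<in> X \<and> v \<in> Y \<or> u \<in> Y \<and> v \<in> X) \<and> (u \<in> S \<longleftrightarrow> v \<in> S)"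
      unfolding arcs using uv cover dj by blast
    consider "u \<in> X" "v \<in> X" | "u \<in> X" "v \<in> Y" | "u \<in> Y" "v \<in> X" | "u \<in> Y" "v \<in> Y"
      using uv by blast
    then show ?thesis
    proof cases
      case 1
      then have "u \<notin> Y" "v \<notin> Y" using disj by auto
      with 1 show ?thesis by (simp add: G R \<phi>)
    next
      case 2
      then show ?thesis by (simp add: G R \<phi> lt hx(2) hy(2))
    next
      case 3
      then show ?thesis by (simp add: G R \<phi> lt hx(2) hy(2))
    next
      case 4
      then have "u \<notin> X" "v \<notin> X" using disj by auto
      with 4 show ?thesis by (simp add: G R \<phi>)
    qed
  qed
  moreover have "{\<phi> ` X, \<phi> ` Y} = {left_part n, right_part n}"
    using bX bY by (simp add: bij_betw_imp_surj_on)
  ultimately have "bipartite_iso G X Y (R_graph n k) (left_part n) (right_part n)"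
    unfolding bipartite_iso_def verts by blast
  with k show ?thesis by blast
qed

section \<open>From the relation back to the graph\<close>

lemma vpath_with_proj_if_path_in:
  assumes "path_in (parcs G) p" "set p = pverts G" "p \<noteq> []"
  shows "vpath p (with_proj G)"
proof -
  have "set (vwalk_arcs p) \<subseteq> parcs G"
    using assms(1) unfolding path_in_def by (induction p rule: vwalk_arcs.induct) auto
  then show ?thesis
    using assms by (auto simp: path_in_def vpath_def vwalk_def arcs_ends_conv with_proj_def)
qed

theorem theorem2p4:
  fixes G :: "'a pair_pre_digraph" and X Y :: "'a set" and n :: nat
  assumes "balanced_bipartite_graph G X Y"
    and "card (pverts G) = 2 * n"
    and "n \<ge> 1"
    and "signless_radius (quasi_complement X Y G) \<le> real n"
  shows "traceable G \<or>
    (\<exists>k \<in> {1..n div 2}. bipartite_iso G X Y (R_graph n k) (left_part n) (right_part n))"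
proof (cases "traceable G")
  case False
  interpret G: balanced_bipartite_graph G X Y by fact
  have finXY: "finite X" "finite Y" using G.pair_finite_verts G.verts_parts by auto
  have n: "card X = n"
    using assms(2) G.verts_parts G.parts_disjoint G.balanced finXY by (simp add: card_Un_disjoint)
  have "sym (parcs G)"
    using G.pair_sym_arcs by (simp add: symmetric_def)
  then have bip: "balanced_relation (parcs G) X Y"
    using finXY G.parts_disjoint G.edges_between G.balanced by unfold_locales
  have ne: "pverts G \<noteq> {}" using assms(2,3) by auto
  have "\<not> balanced_relation.traced (parcs G) X Y"
  proof
    assume "balanced_relation.traced (parcs G) X Y"
    then obtain p where p: "path_in (parcs G) p" "set p = pverts G"
      unfolding balanced_relation.traced_def[OF bip] G.verts_parts by blast
    with ne have "p \<noteq> []" by auto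
    with p vpath_with_proj_if_path_in False show False unfolding traceable_def by blast
  qed
  then obtain R where R: "balanced_relation R X Y" "\<not> balanced_relation.traced R X Y" "parcs G \<subseteq> R"
    and max: "\<And>u v. u \<in> X \<Longrightarrow> v \<in> Y \<Longrightarrow> (u, v) \<notin> R \<Longrightarrow>
      \<exists>p. path_in (R \<union> {(u, v), (v, u)}) p \<and> set p = X \<union> Y"
    using edge_maximal_untraced[OF bip] by blast
  interpret R: balanced_relation R X Y by (rule R(1))
  interpret sw: balanced_relation R Y X by (rule R.swap)
  have gap: "\<exists>A B. R.two_paths A B \<and> last A = u \<and> hd B = v"
    if uv: "u \<in> X" "v \<in> Y" "(u, v) \<notin> R" for u v
    using max[OF uv] R.two_paths_at_nonedge[OF R(2)] by metis
  have upper: "card (R `` {u}) + card (R `` {v}) \<le> n"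
    if uv: "u \<in> X" "v \<in> Y" "(u, v) \<notin> R" for u v
    using gap[OF uv] R.degree_sum_gap(1)[OF R(2)] uv n by blast
  let ?K = "X \<times> Y \<union> Y \<times> X"
  \<comment> \<open>Degrees in the quasi-complement of \<open>R\<close>, not of \<open>G\<close>;
    they are tested against the form of the larger graph
    \<open>quasi_complement X Y G\<close>.\<close>
  define f where "f v = real (card ((?K - R) `` {v}))" for v
  have f: "f v = real n - real (card (R `` {v}))" if "v \<in> X \<union> Y" for v
    using that R.complement_nbrs_P[of v] sw.complement_nbrs_P[of v] n G.balanced
    by (auto simp: f_def Un_commute)
  have H: "pair_graph (quasi_complement X Y G)"
    using bipartite_graph_quasi_complement[of G X Y] G.bipartite_graph_axioms
    by (simp add: bipartite_graph_def)
  have "(\<Sum>(v, w)\<in>?K - parcs G. (f v + f w) * f v)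
      \<le> signless_radius (quasi_complement X Y G) * (\<Sum>v\<in>pverts G. (f v)\<^sup>2)"
    using signless_radius_bounds_quadratic_form[OF H, of f] ne by (simp add: quasi_complement_def)
  also have "\<dots> \<le> real n * (\<Sum>v\<in>pverts G. (f v)\<^sup>2)"
    by (intro mult_right_mono assms(4) sum_nonneg) simp
  finally have bound: "(\<Sum>(v, w)\<in>?K - parcs G. (f v + f w) * f v) \<le> real n * (\<Sum>v\<in>pverts G. (f v)\<^sup>2)" .
  \<comment> \<open>Ore's bound for the missing edges of \<open>R\<close>, rewritten for
    complementary degrees.\<close>
  have lower: "real n \<le> f v + f w" if e: "(v, w) \<in> ?K - R" for v w
  proof -
    have "card (R `` {v}) + card (R `` {w}) \<le> n"
      using e upper[of v w] upper[of w v] R.symD by (auto simp: add.commute)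
    then show ?thesis using f[of v] f[of w] e by auto
  qed
  note test = degree_test_function[of "pverts G" "?K - parcs G" "?K - R" "real n", folded f_def]
  have tight: "f v + f w = real n" if "(v, w) \<in> ?K - R" for v w
    by (rule test(1)) (use that R(3) bound lower finXY in \<open>auto simp: G.verts_parts\<close>)
  \<comment> \<open>Edges of \<open>R\<close> outside \<open>G\<close> belong to the
    quasi-complement of \<open>G\<close> but not to that of \<open>R\<close>.\<close>
  have unused: "f v = 0" if "(v, w) \<in> R - parcs G" for v w
    by (rule test(2)[of v w])
      (use that R(3) R.sub bound lower finXY in \<open>auto simp: G.verts_parts\<close>)
  have deg: "card X \<le> card (R `` {u}) + card (R `` {v})" if "u \<in> X" "v \<in> Y" "(u, v) \<notin> R" for u v
    using tight[of u v] f[of u] f[of v] that n by auto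
  obtain u v where uv: "u \<in> X" "v \<in> Y" "(u, v) \<notin> R"
    using R.nonedge_if_not_traced[OF R(2)] by blast
  from gap[OF uv] obtain A B where "R.two_paths A B" "last A = u" "hd B = v" by blast
  then have blocks: "R.two_blocks (set A) (set B)"
    using R.two_blocks_if_two_paths[OF R(2) _ _ _ deg] uv by blast
  define S T where ST: "S = set A" "T = set B"
  note blocks = blocks[folded ST]
  \<comment> \<open>In the two-block structure every vertex misses the opposite side of the other
    block, so \<open>f\<close> is positive everywhere. An edge of \<open>R\<close> outside
    \<open>G\<close> would have an end \<open>v\<close> with \<open>f v = 0\<close>.\<close>
  have "R = parcs G"
  proof (rule ccontr)
    assume "R \<noteq> parcs G"
    then obtain v w where e: "(v, w) \<in> R - parcs G" using R(3) by auto
    have "card (Y \<inter> S) \<noteq> 0" "card (Y \<inter> T) \<noteq> 0"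
      using blocks finXY unfolding R.two_blocks_def by (metis card_0_eq finite_Int)+
    moreover have cover: "S \<union> T = X \<union> Y" and dj: "S \<inter> T = {}" and "X \<inter> S \<noteq> {}" "X \<inter> T \<noteq> {}"
      and R_eq: "R = ?K \<inter> (S \<times> S \<union> T \<times> T)"
      using blocks unfolding R.two_blocks_def by blast+
    ultimately obtain x x' y y' where
      z: "x \<in> X" "x \<in> S" "x' \<in> X" "x' \<in> T" "y \<in> Y" "y \<in> S" "y' \<in> Y" "y' \<in> T"
      by (metis card.empty disjoint_iff)
    have "v \<in> X \<union> Y" using e R.sub by auto
    then consider "v \<in> X" "v \<in> S" | "v \<in> X" "v \<in> T" | "v \<in> Y" "v \<in> S" | "v \<in> Y" "v \<in> T"
      using cover by blast
    then have "\<exists>z. (v, z) \<in> ?K \<and> (v, z) \<notin> S \<times> S \<union> T \<times> T"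
      by cases (use z dj in blast)+
    then have "\<exists>z. (v, z) \<in> ?K - R" by (subst R_eq) blast
    then have "(?K - R) `` {v} \<noteq> {}" by blast
    moreover have "finite ((?K - R) `` {v})" using finXY by (auto intro: finite_subset[of _ "X \<union> Y"])
    ultimately have "f v \<noteq> 0" by (simp add: f_def)
    with unused[OF e] show False by simp
  qed
  with blocks have ST': "balanced_relation.two_blocks (parcs G) X Y S T" by simp
  \<comment> \<open>The two blocks may be exchanged, so the smaller one can supply
    \<open>k\<close>.\<close>
  moreover have "balanced_relation.two_blocks (parcs G) X Y T S"
    using ST' unfolding balanced_relation.two_blocks_def[OF bip] by (simp add: Un_commute Int_commute)
  ultimately show ?thesis
    using bipartite_iso_R_graph[OF bip G.verts_parts n] nat_le_linear by blast
qed simp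

end
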